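(* Let $K\ge 2$, $\mathcal{K}=\{1,\ldots,K\}$, and let $\lambda_1=1$ and $\lambda_i>0$ for $i=2,\ldots,K$ be fixed. Consider the GPL model on the entities $\mathcal{K}$ with parameters $\vec{\theta}=(\theta_1,\ldots,\theta_K)$ given by $\theta_i=\lambda_i\theta_1$ for $i=1,\ldots,K$ (with $\theta_1>0$ small enough that all $\theta_i\le 1$). Then for every complete ordering without ties $\vec{y}=(y_1,\ldots,y_K)$, i.e. every permutation of $\mathcal{K}$, with associated set indicator $\vec{s}=(1,2,\ldots,K)$, the probability of $(\vec{y},\vec{s})$ under the GPL model satisfies $$\lim_{\theta_1\rightarrow 0^+}\Pr(\vec{y},\vec{s}\mid\vec{\theta})=\prod_{i=1}^{K-1}\frac{\lambda_{y_i}}{\sum_{j=i}^{K}\lambda_{y_j}},$$ where the right-hand side is the Plackett-Luce probability of $\vec{y}$ with parameters $\lambda_1,\ldots,\lambda_K$. Hence the Plackett-Luce model is a limiting special case of the GPL model.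
   Context: A rank ordering with ties of $\mathcal{K}=\{1,\ldots,K\}$ is encoded by a list of the entities $\vec{y}=(y_1,\ldots,y_K)$, from first-ranked to last-ranked, and an ordered set indicator $\vec{s}=(s_1,\ldots,s_K)$, where $s_j$ is the index of the ordered set ("bucket") containing entity $y_j$. Thus $s_1=1$, $s_{j+1}\in\{s_j,s_j+1\}$, and $s_j=s_{j+1}$ if and only if $y_j$ and $y_{j+1}$ are tied. An ordering without ties has $\vec{s}=(1,2,\ldots,K)$. GPL (generalized, or geometric, Plackett-Luce) model: given $\vec{\theta}=(\theta_1,\ldots,\theta_K)$ with $0<\theta_k\le 1$, let $W_1,\ldots,W_K$ be independent with $W_k\sim\mathrm{Geom}(\theta_k)$, i.e. $\Pr(W_k=w)=(1-\theta_k)^{w-1}\theta_k$ for $w\in\{1,2,3,\ldots\}$. The probability $\Pr(\vec{y},\vec{s}\mid\vec{\theta})$ is the probability that the latent variables, arranged from smallest to largest, take the ordering $\vec{y}$ with ties given by $\vec{s}$: for each $j=1,\ldots,K-1$, $W_{y_j}=W_{y_{j+1}}$ if $s_j=s_{j+1}$, and $W_{y_j}<W_{y_{j+1}}$ otherwise. In particular, for an ordering without ties it is $\Pr(W_{y_1}<W_{y_2}<\cdots<W_{y_K})$. Plackett-Luce model: with parameters $\lambda_k>0$, $k\in\mathcal{K}$, the probability of the ordering without ties $\vec{y}$ is $\prod_{j=1}^{K-1}\lambda_{y_j}/\sum_{\ell=j}^{K}\lambda_{y_\ell}$. *)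

theory Defs
  imports "HOL-Probability.Probability"
begin

(* Geometric distribution on {1, 2, 3, ...}; the library's geometric_pmf starts at 0. *)
definition geom1_pmf :: "real \<Rightarrow> nat pmf" where
  "geom1_pmf p = map_pmf Suc (geometric_pmf p)"

lemma pmf_geom1:
  assumes "0 < p" "p \<le> 1" "1 \<le> w"
  shows "pmf (geom1_pmf p) w = (1 - p) ^ (w - 1) * p"
proof -
  obtain v where w: "w = Suc v"
    using assms(3) by (cases w) auto
  have "pmf (map_pmf Suc (geometric_pmf p)) (Suc v) = pmf (geometric_pmf p) v"
    by (rule pmf_map_inj') simp
  then show ?thesis
    using assms by (simp add: geom1_pmf_def w)
qed

(* Joint law of the independent W k ~ Geom (\<theta> k), k = 1, ..., K.  The value 1 that Pi_pmf assigns
   outside {1..K} plays no role.  Meaningful if 0 < \<theta> k \<le> 1 for all k in {1..K}. *)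
definition gpl_latent :: "nat \<Rightarrow> (nat \<Rightarrow> real) \<Rightarrow> (nat \<Rightarrow> nat) pmf" where
  "gpl_latent K \<theta> = Pi_pmf {1..K} 1 (\<lambda>k. geom1_pmf (\<theta> k))"

(* y j is the entity at rank j and s j the index of its bucket, for j = 1, ..., K. *)
definition gpl_prob :: "nat \<Rightarrow> (nat \<Rightarrow> real) \<Rightarrow> (nat \<Rightarrow> nat) \<Rightarrow> (nat \<Rightarrow> nat) \<Rightarrow> real" where
  "gpl_prob K \<theta> y s = measure_pmf.prob (gpl_latent K \<theta>)
     {W. \<forall>j\<in>{1..K-1}. if s j = s (j + 1) then W (y j) = W (y (j + 1))
                                           else W (y j) < W (y (j + 1))}"

definition plackett_luce_prob :: "nat \<Rightarrow> (nat \<Rightarrow> real) \<Rightarrow> (nat \<Rightarrow> nat) \<Rightarrow> real" where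
  "plackett_luce_prob K lam y = (\<Prod>i=1..K-1. lam (y i) / (\<Sum>j=i..K. lam (y j)))"

end

theory Submission
  imports Defs
begin

text \<open>
  Write \<open>q\<^sub>k = 1 - \<theta>\<^sub>k\<close> and \<open>Q\<^sub>j = \<Prod>l=j..K. q (y l)\<close>. Summing over the value of \<open>W (y j)\<close>, the
  probability of \<open>m < W (y j) < \<dots> < W (y K)\<close> is \<open>Q\<^sub>j ^ m\<close> times a constant, by downward induction on
  \<open>j\<close> and a geometric series; hence the ordering without ties has probability
  \<open>\<Prod>j=1..K. \<theta> (y j) * Q\<^sub>j\<^sub>+\<^sub>1 / (1 - Q\<^sub>j)\<close>. For \<open>\<theta>\<^sub>k = \<lambda>\<^sub>k * t\<close> and \<open>t \<rightarrow> 0\<close> we have \<open>Q\<^sub>j\<^sub>+\<^sub>1 \<rightarrow> 1\<close> and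
  \<open>(1 - Q\<^sub>j) / t \<rightarrow> \<Sum>l=j..K. \<lambda> (y l)\<close>, the derivative of a product at \<open>0\<close>; the factor for \<open>j = K\<close>
  tends to \<open>1\<close>.
\<close>

text \<open>The terms with \<open>w \<le> m\<close> vanish; after a shift by \<open>Suc m\<close>
  the rest is a geometric series of ratio \<open>(1 - p) * r\<close>. Since \<open>0 < p\<close>, it
  converges even for \<open>r = 1\<close>, the value of an empty product.\<close>

lemma geometric_tail_sums:
  fixes p r c :: real
  assumes "0 < p" "p \<le> 1" "0 \<le> r" "r \<le> 1"
  shows "(\<lambda>w. pmf (geom1_pmf p) w * (if m < w then r ^ w * c else 0))
           sums (((1 - p) * r) ^ m * (p * r * c / (1 - (1 - p) * r)))"
proof -
  let ?q = "(1 - p) * r"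
  have q: "0 \<le> ?q" "?q < 1"
    using assms mult_left_le[of r "1 - p"] by (auto simp: mult_nonneg_nonneg)
  have "(\<lambda>n. ?q ^ n) sums (1 / (1 - ?q))"
    using q by (intro geometric_sums) simp
  then have "(\<lambda>n. ?q ^ m * (p * r * c) * ?q ^ n) sums (?q ^ m * (p * r * c) * (1 / (1 - ?q)))"
    by (rule sums_mult)
  moreover have "pmf (geom1_pmf p) (n + Suc m) * (if m < n + Suc m then r ^ (n + Suc m) * c else 0)
      = ?q ^ m * (p * r * c) * ?q ^ n" for n
    using assms by (simp add: pmf_geom1 power_add power_mult_distrib)
  ultimately have "(\<lambda>n. pmf (geom1_pmf p) (n + Suc m) *
      (if m < n + Suc m then r ^ (n + Suc m) * c else 0)) sums (?q ^ m * (p * r * c / (1 - ?q)))"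
    by (simp only:) simp
  then show ?thesis
    by (subst (asm) sums_zero_iff_shift) auto
qed

text \<open>Conditioning on the first of two independent coordinates: the slices are disjoint, so
  countable additivity sums their probabilities.\<close>

lemma prob_pair_pmf_sums:
  fixes M :: "nat pmf"
  shows "(\<lambda>w. pmf M w * measure_pmf.prob N {f. P w f}) sums
           measure_pmf.prob (pair_pmf M N) {(w, f). P w f}"
proof -
  let ?A = "\<lambda>w. {w} \<times> {f. P w f}"
  have "disjoint_family ?A"
    by (auto simp: disjoint_family_on_def)
  then have "(\<lambda>w. measure_pmf.prob (pair_pmf M N) (?A w)) sums
      measure_pmf.prob (pair_pmf M N) (\<Union>w. ?A w)"
    by (intro measure_pmf.finite_measure_UNION) auto
  moreover have "measure_pmf.prob (pair_pmf M N) (?A w) = pmf M w * measure_pmf.prob N {f. P w f}" for w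
  proof -
    \<comment> \<open>The product rule asks for countable sets. Cutting the slice down to the
      support of \<open>N\<close> makes it countable and changes it only by a null set.\<close>
    have "measure_pmf.prob (pair_pmf M N) (?A w)
        = measure_pmf.prob (pair_pmf M N) ({w} \<times> ({f. P w f} \<inter> set_pmf N))"
      by (intro measure_pmf.finite_measure_eq_AE) (auto simp: AE_measure_pmf_iff)
    also have "\<dots> = pmf M w * measure_pmf.prob N ({f. P w f} \<inter> set_pmf N)"
      by (subst measure_pmf_prob_product) (auto simp: measure_pmf_single)
    finally show ?thesis by (simp add: measure_Int_set_pmf)
  qed
  moreover have "(\<Union>w. ?A w) = {(w, f). P w f}" by auto
  ultimately show ?thesis by simp
qed

text \<open>The lower bound \<open>m\<close> stays arbitrary in the induction because the hypothesis
  for \<open>Suc i\<close> is used with every value \<open>w\<close> of \<open>W (y i)\<close> as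
  the new bound.\<close>

lemma prob_geom1_chain:
  fixes K :: nat and \<theta> :: "nat \<Rightarrow> real" and y :: "nat \<Rightarrow> nat"
  defines "Q \<equiv> \<lambda>i. \<Prod>l=i..K. 1 - \<theta> (y l)"
  assumes "i \<le> Suc K" "inj_on y {i..K}" "\<And>l. l \<in> {i..K} \<Longrightarrow> 0 < \<theta> (y l) \<and> \<theta> (y l) \<le> 1"
  shows "measure_pmf.prob (Pi_pmf (y ` {i..K}) d (\<lambda>k. geom1_pmf (\<theta> k)))
           {W. sorted_wrt (<) (m # map (\<lambda>j. W (y j)) [i..<Suc K])}
         = Q i ^ m * (\<Prod>j=i..K. \<theta> (y j) * Q (Suc j) / (1 - Q j))"
  using assms(2-4)
proof (induction i arbitrary: m rule: inc_induct)
  case base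
  then show ?case by (simp add: Q_def)
next
  case (step i)
  let ?A = "y ` {Suc i..K}" and ?p = "\<lambda>k. geom1_pmf (\<theta> k)"
  let ?S = "\<lambda>w W. sorted_wrt (<) (w # map (\<lambda>j. W (y j)) [Suc i..<Suc K])"
  let ?c = "\<Prod>j=Suc i..K. \<theta> (y j) * Q (Suc j) / (1 - Q j)"
  have iK: "{i..K} = insert i {Suc i..K}" using step.hyps by auto
  have yi: "y i \<notin> ?A" using step.prems(1) iK by (auto simp: inj_on_def)
  have IH: "measure_pmf.prob (Pi_pmf ?A d ?p) {W. ?S w W} = Q (Suc i) ^ w * ?c" for w
    using step.prems iK by (intro step.IH) auto
  have Qi: "Q i = (1 - \<theta> (y i)) * Q (Suc i)" by (simp add: Q_def iK)
  have Q: "0 \<le> Q (Suc i)" "Q (Suc i) \<le> 1"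
  proof -
    have "0 \<le> 1 - \<theta> (y l) \<and> 1 - \<theta> (y l) \<le> 1" if "l \<in> {Suc i..K}" for l
      using step.prems(2)[of l] that by simp
    then show "0 \<le> Q (Suc i)" "Q (Suc i) \<le> 1"
      unfolding Q_def by (blast intro: prod_nonneg prod_le_1)+
  qed
  \<comment> \<open>Overwriting \<open>W\<close> at \<open>y i\<close> leaves the later entries
    alone, as \<open>y\<close> is injective; by transitivity only \<open>m < w\<close> and the chain
    above \<open>w\<close> remain to be compared.\<close>
  have ev: "(\<lambda>(w, f). f(y i := w)) -` {W. sorted_wrt (<) (m # map (\<lambda>j. W (y j)) [i..<Suc K])}
      = {(w, W). m < w \<and> ?S w W}"
  proof -
    have "map (\<lambda>j. (W(y i := w)) (y j)) [Suc i..<Suc K] = map (\<lambda>j. W (y j)) [Suc i..<Suc K]" for W :: "nat \<Rightarrow> nat" and w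
    proof (intro map_cong refl)
      fix j assume "j \<in> set [Suc i..<Suc K]"
      then have "y j \<in> ?A" by auto
      then have "y j \<noteq> y i" using yi by metis
      then show "(W(y i := w)) (y j) = W (y j)" by simp
    qed
    moreover have "[i..<Suc K] = i # [Suc i..<Suc K]"
      using step.hyps by (intro upt_conv_Cons) auto
    ultimately have "map (\<lambda>j. (W(y i := w)) (y j)) [i..<Suc K]
        = w # map (\<lambda>j. W (y j)) [Suc i..<Suc K]" for W :: "nat \<Rightarrow> nat" and w
      by (simp only: list.map fun_upd_same)
    then show ?thesis
      by (simp only: vimage_def mem_Collect_eq case_prod_beta' sorted_wrt2[OF transp_on_less])
  qed
  have prob: "measure_pmf.prob (Pi_pmf ?A d ?p) {W. m < w \<and> ?S w W}
      = (if m < w then Q (Suc i) ^ w * ?c else 0)" for w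
    by (cases "m < w") (simp_all only: IH simp_thms if_True if_False Collect_const measure_empty)
  have "(\<lambda>w. pmf (?p (y i)) w * (if m < w then Q (Suc i) ^ w * ?c else 0)) sums
      measure_pmf.prob (pair_pmf (?p (y i)) (Pi_pmf ?A d ?p)) {(w, W). m < w \<and> ?S w W}"
    unfolding prob[symmetric] by (rule prob_pair_pmf_sums)
  moreover have "(\<lambda>w. pmf (?p (y i)) w * (if m < w then Q (Suc i) ^ w * ?c else 0)) sums
      (Q i ^ m * (\<theta> (y i) * Q (Suc i) * ?c / (1 - Q i)))"
    unfolding Qi using step.prems(2)[of i] iK Q by (intro geometric_tail_sums) auto
  ultimately have "measure_pmf.prob (pair_pmf (?p (y i)) (Pi_pmf ?A d ?p)) {(w, W). m < w \<and> ?S w W}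
      = Q i ^ m * (\<theta> (y i) * Q (Suc i) * ?c / (1 - Q i))"
    by (rule sums_unique2)
  moreover have "Pi_pmf (y ` {i..K}) d ?p
      = map_pmf (\<lambda>(w, f). f(y i := w)) (pair_pmf (?p (y i)) (Pi_pmf ?A d ?p))"
    unfolding iK image_insert using yi by (intro Pi_pmf_insert) auto
  ultimately show ?case
    by (simp only: measure_map_pmf ev) (simp add: iK)
qed

text \<open>Latent values are at least \<open>1\<close>, so the bound \<open>0\<close> is free: this
  is the chain probability for \<open>i = 1\<close> and \<open>m = 0\<close>, where the power of
  \<open>Q 1\<close> is \<open>1\<close>.\<close>

lemma gpl_prob_no_ties:
  fixes K :: nat and \<theta> :: "nat \<Rightarrow> real" and y :: "nat \<Rightarrow> nat"
  defines "Q \<equiv> \<lambda>i. \<Prod>l=i..K. 1 - \<theta> (y l)"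
  assumes y: "bij_betw y {1..K} {1..K}" and \<theta>: "\<And>k. k \<in> {1..K} \<Longrightarrow> 0 < \<theta> k \<and> \<theta> k \<le> 1"
  shows "gpl_prob K \<theta> y (\<lambda>j. j) = (\<Prod>j=1..K. \<theta> (y j) * Q (Suc j) / (1 - Q j))"
proof -
  let ?L = "\<lambda>W. map (\<lambda>j. W (y j)) [1..<Suc K] :: nat list"
  let ?P = "Pi_pmf {1..K} 1 (\<lambda>k. geom1_pmf (\<theta> k))"
  have img: "y ` {1..K} = {1..K}" and inj: "inj_on y {1..K}"
    using y by (auto simp: bij_betw_def)
  have y\<theta>: "0 < \<theta> (y l) \<and> \<theta> (y l) \<le> 1" if "l \<in> {1..K}" for l
    using \<theta> img that by blast
  have supp: "0 < W (y j)" if "W \<in> set_pmf ?P" "j \<in> {1..K}" for W j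
  proof -
    have "y j \<in> {1..K}" using that(2) img by blast
    then have "W (y j) \<in> set_pmf (geom1_pmf (\<theta> (y j)))"
      using that(1) by (auto simp: set_Pi_pmf PiE_dflt_def)
    then show ?thesis by (auto simp: geom1_pmf_def)
  qed
  have chain: "(\<forall>j\<in>{1..K-1}. W (y j) < W (y (j + 1))) \<longleftrightarrow> sorted_wrt (<) (?L W)" for W
  proof -
    \<comment> \<open>List positions count from \<open>0\<close>, so position \<open>i\<close> holds
      the value at rank \<open>Suc i\<close>.\<close>
    have "sorted_wrt (<) (?L W) \<longleftrightarrow> (\<forall>i. Suc i < K \<longrightarrow> W (y (Suc i)) < W (y (Suc (Suc i))))"
      by (simp add: sorted_wrt_iff_nth_Suc_transp transp_on_def del: upt_Suc)
    also have "\<dots> \<longleftrightarrow> (\<forall>j\<in>{1..K-1}. W (y j) < W (y (j + 1)))"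
    proof (intro iffI ballI allI impI)
      fix j assume "\<forall>i. Suc i < K \<longrightarrow> W (y (Suc i)) < W (y (Suc (Suc i)))" "j \<in> {1..K-1}"
      then show "W (y j) < W (y (j + 1))" by (cases j) auto
    qed auto
    finally show ?thesis by simp
  qed
  have "gpl_prob K \<theta> y (\<lambda>j. j) = measure_pmf.prob ?P {W. sorted_wrt (<) (?L W)}"
    unfolding gpl_prob_def gpl_latent_def using chain by simp
  also have "\<dots> = measure_pmf.prob ?P {W. sorted_wrt (<) (0 # ?L W)}"
    using supp by (intro measure_pmf.finite_measure_eq_AE) (auto simp: AE_measure_pmf_iff simp del: upt_Suc)
  also have "\<dots> = (\<Prod>j=1..K. \<theta> (y j) * Q (Suc j) / (1 - Q j))"
    using prob_geom1_chain[of 1 K y \<theta> 1 0] inj y\<theta> unfolding img Q_def by simp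
  finally show ?thesis .
qed

text \<open>Up to sign this is the difference quotient at \<open>0\<close> of a product that equals
  \<open>1\<close> there.\<close>

lemma one_minus_prod_over_tendsto:
  fixes a :: "'a \<Rightarrow> real"
  assumes "finite A"
  shows "((\<lambda>t. (1 - (\<Prod>l\<in>A. 1 - a l * t)) / t) \<longlongrightarrow> (\<Sum>l\<in>A. a l)) (at 0)"
proof -
  have "((\<lambda>t. \<Prod>l\<in>A. 1 - a l * t) has_field_derivative
      (\<Sum>l\<in>A. - a l * (\<Prod>k\<in>A - {l}. 1 - a k * 0))) (at 0)"
    by (intro has_field_derivative_prod) (auto intro!: derivative_eq_intros)
  then have "((\<lambda>t. - (((\<Prod>l\<in>A. 1 - a l * t) - 1) / t)) \<longlongrightarrow> - (- (\<Sum>l\<in>A. a l))) (at 0)"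
    by (intro tendsto_minus) (simp add: has_field_derivative_iff sum_negf)
  then show ?thesis by (simp add: minus_divide_left)
qed

theorem theorem1:
  fixes K :: nat and lam :: "nat \<Rightarrow> real" and y :: "nat \<Rightarrow> nat"
  assumes "K \<ge> 2"
    and "lam 1 = 1"
    and "\<forall>i\<in>{2..K}. lam i > 0"
    and "bij_betw y {1..K} {1..K}"
  shows "((\<lambda>\<theta>1. gpl_prob K (\<lambda>i. lam i * \<theta>1) y (\<lambda>j. j)) \<longlongrightarrow> plackett_luce_prob K lam y) (at_right 0)"
proof -
  let ?Q = "\<lambda>t i. \<Prod>l=i..K. 1 - lam (y l) * t"
  let ?S = "\<lambda>i. \<Sum>l=i..K. lam (y l)"
  have lam: "0 < lam k" if "k \<in> {1..K}" for k
    using that assms(2,3) by (cases "k = 1") auto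
  have ylam: "0 < lam (y j)" if "j \<in> {1..K}" for j
    using that assms(4) by (intro lam bij_betwE[OF assms(4), rule_format])
  have small: "eventually (\<lambda>t. \<forall>k\<in>{1..K}. 0 < lam k * t \<and> lam k * t \<le> 1) (at_right 0)"
  proof (intro eventually_ball_finite ballI)
    fix k assume "k \<in> {1..K}"
    then have "0 < lam k" by (rule lam)
    then show "eventually (\<lambda>t. 0 < lam k * t \<and> lam k * t \<le> 1) (at_right 0)"
      by (intro eventually_at_rightI[of 0 "1 / lam k"]) (auto simp: field_simps)
  qed simp
  have factor: "((\<lambda>t. lam (y j) * t * ?Q t (Suc j) / (1 - ?Q t j)) \<longlongrightarrow> lam (y j) / ?S j) (at_right 0)"
    if j: "j \<in> {1..K}" for j
  proof -
    have "0 < ?S j" using j ylam by (intro sum_pos) auto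
    moreover have "((\<lambda>t. (1 - ?Q t j) / t) \<longlongrightarrow> ?S j) (at_right 0)"
      by (rule tendsto_mono[OF at_le one_minus_prod_over_tendsto]) auto
    moreover have "((\<lambda>t. lam (y j) * ?Q t (Suc j)) \<longlongrightarrow> lam (y j) * ?Q 0 (Suc j)) (at_right 0)"
      by (intro tendsto_intros)
    \<comment> \<open>Moving \<open>t\<close> under \<open>1 - ?Q t j\<close> replaces the form 0/0
      by a quotient whose denominator has the positive limit \<open>?S j\<close>.\<close>
    ultimately have "((\<lambda>t. lam (y j) * ?Q t (Suc j) / ((1 - ?Q t j) / t)) \<longlongrightarrow>
        lam (y j) * ?Q 0 (Suc j) / ?S j) (at_right 0)"
      by (intro tendsto_divide) auto
    then show ?thesis by (simp add: mult_ac)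
  qed
  have lim: "((\<lambda>t. \<Prod>j=1..K. lam (y j) * t * ?Q t (Suc j) / (1 - ?Q t j)) \<longlongrightarrow>
      (\<Prod>j=1..K. lam (y j) / ?S j)) (at_right 0)"
    by (intro tendsto_prod factor)
  \<comment> \<open>The Plackett-Luce product stops at \<open>K - 1\<close>; the extra factor is
    \<open>lam (y K) / lam (y K) = 1\<close>.\<close>
  have PL: "(\<Prod>j=1..K. lam (y j) / ?S j) = plackett_luce_prob K lam y"
  proof -
    have "{1..K} = insert K {1..K-1}" using assms(1) by auto
    then have "(\<Prod>j=1..K. lam (y j) / ?S j) = lam (y K) / ?S K * (\<Prod>j=1..K-1. lam (y j) / ?S j)"
      using assms(1) by simp
    then show ?thesis
      using ylam[of K] assms(1) by (simp add: plackett_luce_prob_def)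
  qed
  \<comment> \<open>The closed form is available only while all parameters lie in (0, 1], hence only
    for small positive \<open>t\<close>.\<close>
  have "eventually (\<lambda>t. (\<Prod>j=1..K. lam (y j) * t * ?Q t (Suc j) / (1 - ?Q t j))
      = gpl_prob K (\<lambda>i. lam i * t) y (\<lambda>j. j)) (at_right 0)"
    using small by eventually_elim (rule gpl_prob_no_ties[OF assms(4), symmetric], blast)
  with lim show ?thesis
    unfolding PL by (rule Lim_transform_eventually)
qed

end
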